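(* Let $(a_n)$ be an arithmetic sequence and let $(e_n)$ be an arithmetic-type sequence corresponding to $(a_n)$. If $(e_n)$ is weakly $L$-invariant, then $|t^{s}_{(e_n)}(\mathbb{T})\setminus t_{(e_n)}(\mathbb{T})|=\mathfrak{c}$.
   Context: $\mathbb{N}=\{1,2,3,\dots\}$, $\mathbb{T}=\mathbb{R}/\mathbb{Z}$, $\mathfrak{c}$ is the cardinality of the continuum, $[m,n]$ denotes the set of integers $j$ with $m\le j\le n$, and $\|x\|$ denotes the distance from a real $x$ to the nearest integer (well defined on $\mathbb{T}$). For $A\subseteq\mathbb{N}$, $\overline{d}(A)=\limsup_{n\to\infty}|A\cap[0,n-1]|/n$, $\underline{d}(A)=\liminf_{n\to\infty}|A\cap[0,n-1]|/n$, and $d(A)$ denotes the common value when they agree (natural density). An arithmetic sequence is a sequence of positive integers $1=a_0<a_1<a_2<\cdots$ with $a_n\mid a_{n+1}$ for every $n$; its ratios are $b_n=a_n/a_{n-1}$ for $n\ge 1$. Let $(d_n)$ be the increasing enumeration of the set $\{r a_k : k\ge 0,\ 1\le r<b_{k+1}\}$. An arithmetic-type sequence corresponding to $(a_n)$ is a strictly increasing sequence of integers $(e_n)_{n\in\mathbb{N}}$ such that $(a_n)$ is a subsequence of $(e_n)$ and $(e_n)$ is a subsequence of $(d_n)$. For $k\ge 0$, $n_k$ denotes the index with $e_{n_k}=a_k$ (so $n_0=1$). The lifting function $L:\mathcal{P}(\mathbb{N})\to\mathcal{P}(\mathbb{N})$ is $L(A)=\bigcup_{k\in A}[n_{k-1},n_k-1]$.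 For $m\in\mathbb{N}\cup\{0\}$, $A-m=\{n\in\mathbb{N}: n=a-m \text{ for some } a\in A\}$. $(e_n)$ is weakly $L$-invariant if there exists an infinite $A\subseteq\mathbb{N}$ such that $d(L(A-m))=0$ for each $m\in\mathbb{N}\cup\{0\}$. The characterized subgroup is $t_{(e_n)}(\mathbb{T})=\{x\in\mathbb{T}: e_nx\to 0 \text{ in } \mathbb{T}\}$. The statistically characterized subgroup is $t^s_{(e_n)}(\mathbb{T})=\{x\in\mathbb{T}: e_nx\to 0 \text{ statistically}\}$, i.e. the set of $x\in\mathbb{T}$ such that $d(\{n\in\mathbb{N}:\|e_nx\|\ge\varepsilon\})=0$ for every $\varepsilon>0$. *)

theory Defs
  imports "HOL-Analysis.Analysis" "HOL-Library.Equipollence"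
begin

section \<open>The circle group\<close>

text \<open>\<open>infdist x \<int>\<close> is the distance from the real \<open>x\<close> to the nearest integer.\<close>

lemma infdist_Ints_eq_round: "infdist x \<int> = \<bar>x - of_int (round x)\<bar>" for x :: real
proof (rule antisym)
  show "infdist x \<int> \<le> \<bar>x - of_int (round x)\<bar>"
    using infdist_le[of "of_int (round x)" "\<int>" x] by (simp add: dist_real_def)
  have "\<bar>x - of_int (round x)\<bar> \<le> dist x z" if "z \<in> \<int>" for z
    using that by (elim Ints_cases) (simp add: dist_real_def round_diff_minimal)
  then show "\<bar>x - of_int (round x)\<bar> \<le> infdist x \<int>"
    by (subst infdist_notempty) (auto intro!: cINF_greatest)
qed

lemma infdist_Ints_le: "infdist x \<int> \<le> \<bar>x - of_int k\<bar>" for x :: real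
  by (simp add: infdist_Ints_eq_round round_diff_minimal)

lemma infdist_Ints_zero_iff: "infdist x \<int> = 0 \<longleftrightarrow> x \<in> \<int>" for x :: real
proof
  assume "infdist x \<int> = 0"
  then have "x = of_int (round x)" by (simp add: infdist_Ints_eq_round)
  then show "x \<in> \<int>" by (metis Ints_of_int)
qed simp

lemma infdist_Ints_triangle: "infdist (x + y) \<int> \<le> infdist x \<int> + infdist y \<int>" for x y :: real
  using infdist_Ints_le[of "x + y" "round x + round y"] by (simp add: infdist_Ints_eq_round)

lemma infdist_Ints_minus: "infdist (- x) \<int> = infdist x \<int>" for x :: real
  using infdist_Ints_le[of "- x" "- round x"] infdist_Ints_le[of x "- round (- x)"]
  by (simp add: infdist_Ints_eq_round)

lemma infdist_Ints_cong:
  fixes x y :: real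
  assumes "x - y \<in> \<int>"
  shows "infdist x \<int> = infdist y \<int>"
proof -
  have "infdist (x - y) \<int> = 0" "infdist (y - x) \<int> = 0"
    using assms infdist_Ints_minus[of "x - y"] by (simp_all add: infdist_Ints_zero_iff)
  then show ?thesis
    using infdist_Ints_triangle[of "x - y" y] infdist_Ints_triangle[of "y - x" x] by simp
qed

quotient_type circle = real / "\<lambda>x y. x - y \<in> \<int>"
proof (rule equivpI)
  show "reflp (\<lambda>x y :: real. x - y \<in> \<int>)" by (simp add: reflp_def)
  show "symp (\<lambda>x y :: real. x - y \<in> \<int>)"
    by (rule sympI) (metis Ints_minus minus_diff_eq)
  show "transp (\<lambda>x y :: real. x - y \<in> \<int>)"
  proof (rule transpI)
    fix x y z :: real assume "x - y \<in> \<int>" "y - z \<in> \<int>"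
    then have "(x - y) + (y - z) \<in> \<int>" by (rule Ints_add)
    then show "x - z \<in> \<int>" by simp
  qed
qed

instantiation circle :: ab_group_add
begin

lift_definition zero_circle :: circle is "0 :: real" .

lift_definition plus_circle :: "circle \<Rightarrow> circle \<Rightarrow> circle" is "\<lambda>x y. x + y"
proof -
  fix x x' y y' :: real assume "x - x' \<in> \<int>" "y - y' \<in> \<int>"
  then have "(x - x') + (y - y') \<in> \<int>" by (rule Ints_add)
  then show "(x + y) - (x' + y') \<in> \<int>" by (simp add: algebra_simps)
qed

lift_definition uminus_circle :: "circle \<Rightarrow> circle" is "\<lambda>x. - x"
  by (metis Ints_minus minus_diff_eq minus_diff_minus)

lift_definition minus_circle :: "circle \<Rightarrow> circle \<Rightarrow> circle" is "\<lambda>x y. x - y"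
proof -
  fix x x' y y' :: real assume "x - x' \<in> \<int>" "y - y' \<in> \<int>"
  then have "(x - x') - (y - y') \<in> \<int>" by (rule Ints_diff)
  then show "(x - y) - (x' - y') \<in> \<int>" by (simp add: algebra_simps)
qed

instance
  by standard (transfer; simp)+

end

lift_definition circle_mult :: "nat \<Rightarrow> circle \<Rightarrow> circle" is "\<lambda>n x. real n * x"
  by (metis Ints_mult Ints_of_nat right_diff_distrib)

lift_definition circle_norm :: "circle \<Rightarrow> real" is "\<lambda>x. infdist x \<int>"
  by (rule infdist_Ints_cong)

text \<open>The metric \<open>\<parallel>x - y\<parallel>\<close> induces the quotient topology of \<open>\<real>/\<int>\<close>;
  see \<open>open_circle_iff\<close> below.\<close>

instantiation circle :: metric_space
begin

definition dist_circle :: "circle \<Rightarrow> circle \<Rightarrow> real" where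
  "dist_circle x y = circle_norm (x - y)"

definition uniformity_circle :: "(circle \<times> circle) filter" where
  "uniformity_circle = (INF e\<in>{0<..}. principal {(x, y). dist x y < e})"

definition open_circle :: "circle set \<Rightarrow> bool" where
  "open_circle U \<longleftrightarrow> (\<forall>x\<in>U. eventually (\<lambda>(x', y). x' = x \<longrightarrow> y \<in> U) uniformity)"

instance
proof
  fix x y z :: circle
  show "dist x y = 0 \<longleftrightarrow> x = y"
    unfolding dist_circle_def by transfer (rule infdist_Ints_zero_iff)
  show "dist x y \<le> dist x z + dist y z"
    unfolding dist_circle_def
  proof transfer
    fix x y z :: real
    show "infdist (x - y) \<int> \<le> infdist (x - z) \<int> + infdist (y - z) \<int>"
      using infdist_Ints_triangle[of "x - z" "z - y"] infdist_Ints_minus[of "y - z"] by simp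
  qed
qed (simp_all add: uniformity_circle_def open_circle_def)

end

lemma open_circle_iff: "open S \<longleftrightarrow> open (abs_circle -` S)"
proof
  have d: "dist (abs_circle x) (abs_circle y) = infdist (x - y) \<int>" for x y
    by (simp add: dist_circle_def minus_circle.abs_eq circle_norm.abs_eq)
  {
    assume S: "open S"
    show "open (abs_circle -` S)"
      unfolding open_dist
    proof
      fix x assume "x \<in> abs_circle -` S"
      then obtain e where e: "e > 0" "\<And>y. dist y (abs_circle x) < e \<Longrightarrow> y \<in> S"
        using S unfolding open_dist by auto
      have "y \<in> abs_circle -` S" if "dist y x < e" for y
        using e(2)[of "abs_circle y"] that infdist_Ints_le[of "y - x" 0]
        by (simp add: d dist_real_def)
      with e(1) show "\<exists>e>0. \<forall>y. dist y x < e \<longrightarrow> y \<in> abs_circle -` S" by blast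
    qed
  next
    assume S: "open (abs_circle -` S)"
    show "open S"
      unfolding open_dist
    proof
      fix p assume "p \<in> S"
      obtain x where p: "p = abs_circle x" by (metis Quotient3_abs_rep Quotient3_circle)
      with \<open>p \<in> S\<close> S obtain e where e: "e > 0" "\<And>y. dist y x < e \<Longrightarrow> abs_circle y \<in> S"
        unfolding open_dist by auto
      have "q \<in> S" if q: "dist q p < e" for q
      proof -
        obtain y where y: "q = abs_circle y" by (metis Quotient3_abs_rep Quotient3_circle)
        define y' where "y' = y - of_int (round (y - x))"
        have "abs_circle y' = abs_circle y"
          by (simp add: y'_def circle.abs_eq_iff)
        moreover have "dist y' x < e"
          using q by (simp add: y p d infdist_Ints_eq_round y'_def dist_real_def algebra_simps)
        ultimately show ?thesis using e(2) y by metis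
      qed
      with e(1) show "\<exists>e>0. \<forall>y. dist y p < e \<longrightarrow> y \<in> S" by blast
    qed
  }
qed

section \<open>Density\<close>

text \<open>The positive integers \<open>\<nat> = {1, 2, 3, \<dots>}\<close> are represented throughout by \<open>{1..} :: nat set\<close>.\<close>

definition upper_density :: "nat set \<Rightarrow> ereal" where
  "upper_density A = limsup (\<lambda>n. ereal (real (card (A \<inter> {0..<n})) / real n))"

definition lower_density :: "nat set \<Rightarrow> ereal" where
  "lower_density A = liminf (\<lambda>n. ereal (real (card (A \<inter> {0..<n})) / real n))"

definition has_density :: "nat set \<Rightarrow> real \<Rightarrow> bool" where
  "has_density A c \<longleftrightarrow> upper_density A = ereal c \<and> lower_density A = ereal c"

section \<open>Arithmetic and arithmetic-type sequences\<close>

definition arithmetic_seq :: "(nat \<Rightarrow> nat) \<Rightarrow> bool" where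
  "arithmetic_seq a \<longleftrightarrow> a 0 = 1 \<and> strict_mono a \<and> (\<forall>n. a n dvd a (Suc n))"

text \<open>\<open>ratio a n\<close> is meaningful for \<open>n \<ge> 1\<close>; the division is exact for an arithmetic sequence.\<close>

definition ratio :: "(nat \<Rightarrow> nat) \<Rightarrow> nat \<Rightarrow> nat" where
  "ratio a n = a n div a (n - 1)"

definition d_set :: "(nat \<Rightarrow> nat) \<Rightarrow> nat set" where
  "d_set a = {r * a k | r k. 1 \<le> r \<and> r < ratio a (k + 1)}"

definition d_seq :: "(nat \<Rightarrow> nat) \<Rightarrow> nat \<Rightarrow> nat" where
  "d_seq a = enumerate (d_set a)"

text \<open>The sequence \<open>(e\<^sub>n)\<close> is indexed by \<open>n \<ge> 1\<close>, and the value \<open>e 0\<close> plays no role,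
  whereas \<open>(a\<^sub>n)\<close> and \<open>d_seq a\<close> are indexed from \<open>0\<close>. The values of \<open>e\<close> are positive
  because they occur in \<open>d_seq a\<close>, so nothing is lost by taking them in \<open>nat\<close>.\<close>

definition arithmetic_type_seq :: "(nat \<Rightarrow> nat) \<Rightarrow> (nat \<Rightarrow> nat) \<Rightarrow> bool" where
  "arithmetic_type_seq a e \<longleftrightarrow>
     strict_mono_on {1..} e \<and>
     (\<exists>\<sigma>. strict_mono \<sigma> \<and> (\<forall>k. 1 \<le> \<sigma> k \<and> a k = e (\<sigma> k))) \<and>
     (\<exists>\<tau>. strict_mono_on {1..} \<tau> \<and> (\<forall>n\<ge>1. e n = d_seq a (\<tau> n)))"

text \<open>The index written \<open>n\<^sub>k\<close>; it exists and is unique for an arithmetic-type sequence.\<close>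

definition a_index :: "(nat \<Rightarrow> nat) \<Rightarrow> (nat \<Rightarrow> nat) \<Rightarrow> nat \<Rightarrow> nat" where
  "a_index a e k = (THE n. 1 \<le> n \<and> e n = a k)"

text \<open>Only applied to sets \<open>A \<subseteq> {1..}\<close>, so that \<open>k - 1\<close> does not truncate.\<close>

definition lifting :: "(nat \<Rightarrow> nat) \<Rightarrow> (nat \<Rightarrow> nat) \<Rightarrow> nat set \<Rightarrow> nat set" where
  "lifting a e A = (\<Union>k\<in>A. {a_index a e (k - 1) .. a_index a e k - 1})"

definition shift_down :: "nat set \<Rightarrow> nat \<Rightarrow> nat set" where
  "shift_down A m = {n. 1 \<le> n \<and> (\<exists>x\<in>A. int n = int x - int m)}"

definition weakly_L_invariant :: "(nat \<Rightarrow> nat) \<Rightarrow> (nat \<Rightarrow> nat) \<Rightarrow> bool" where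
  "weakly_L_invariant a e \<longleftrightarrow>
     (\<exists>A\<subseteq>{1..}. infinite A \<and> (\<forall>m. has_density (lifting a e (shift_down A m)) 0))"

section \<open>Characterized subgroups\<close>

definition char_subgroup :: "(nat \<Rightarrow> nat) \<Rightarrow> circle set" where
  "char_subgroup e = {x. (\<lambda>n. circle_mult (e n) x) \<longlonglongrightarrow> 0}"

definition stat_char_subgroup :: "(nat \<Rightarrow> nat) \<Rightarrow> circle set" where
  "stat_char_subgroup e =
     {x. \<forall>\<epsilon>>0. has_density {n. 1 \<le> n \<and> circle_norm (circle_mult (e n) x) \<ge> \<epsilon>} 0}"

end

theory Submission
  imports Defs
begin

text \<open>
  Let \<open>A\<close> witness weak \<open>L\<close>-invariance and put \<open>x\<^sub>S = (\<Sum>j\<in>S. \<lfloor>b\<^sub>j/2\<rfloor> / a\<^sub>j)\<close> for \<open>S \<subseteq> A\<close>.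
  For \<open>n \<in> [n\<^bsub>k-1\<^esub>, n\<^sub>k - 1]\<close> the integer \<open>e\<^sub>n\<close> is a multiple of \<open>a\<^bsub>k-1\<^esub>\<close> smaller than \<open>a\<^sub>k\<close>, so
  if \<open>S\<close> misses \<open>[k, k + m]\<close> then \<open>\<parallel>e\<^sub>n x\<^sub>S\<parallel> \<le> a\<^sub>k / a\<^bsub>k+m\<^esub> \<le> 2\<^bsup>-m\<^esup>\<close>; the remaining \<open>n\<close> lie in the
  null set \<open>\<Union>i\<le>m. L(A - i)\<close>. Hence \<open>e\<^sub>n x\<^sub>S \<rightarrow> 0\<close> statistically. If moreover the elements of \<open>S\<close> lie
  in one infinite class of \<open>A\<close> modulo 3, the gaps in \<open>S\<close> make \<open>\<parallel>a\<^bsub>k-1\<^esub> x\<^sub>S\<parallel> \<ge> 1/4\<close> for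
  \<open>k \<in> S\<close> and \<open>\<le> 1/8\<close> for the other \<open>k\<close> of this class. So \<open>S\<close> can be read off \<open>x\<^sub>S\<close>, and
  \<open>x\<^sub>S\<close> is outside the characterized subgroup whenever \<open>S\<close> is infinite.
\<close>

section \<open>Sets of density zero\<close>

lemma has_density_iff_tendsto:
  "has_density A c \<longleftrightarrow> (\<lambda>n. real (card (A \<inter> {0..<n})) / real n) \<longlonglongrightarrow> c"
proof -
  have "has_density A c \<longleftrightarrow> (\<lambda>n. ereal (real (card (A \<inter> {0..<n})) / real n)) \<longlonglongrightarrow> ereal c"
    unfolding has_density_def upper_density_def lower_density_def
    by (subst tendsto_iff_Liminf_eq_Limsup) auto
  then show ?thesis by simp
qed

lemma has_density_0_subset:
  assumes "has_density B 0" "A \<subseteq> B"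
  shows "has_density A 0"
proof -
  have "real (card (A \<inter> {0..<n})) / real n \<le> real (card (B \<inter> {0..<n})) / real n" for n
    using assms(2) by (intro divide_right_mono of_nat_mono card_mono) auto
  then show ?thesis
    unfolding has_density_iff_tendsto
    by (intro tendsto_sandwich[where f = "\<lambda>_. 0", OF _ _ tendsto_const
          assms(1)[unfolded has_density_iff_tendsto]]) auto
qed

lemma has_density_0_Un:
  assumes "has_density A 0" "has_density B 0"
  shows "has_density (A \<union> B) 0"
proof -
  have lim: "(\<lambda>n. real (card (A \<inter> {0..<n})) / real n + real (card (B \<inter> {0..<n})) / real n) \<longlonglongrightarrow> 0"
    using tendsto_add[OF assms[unfolded has_density_iff_tendsto]] by simp
  have "real (card ((A \<union> B) \<inter> {0..<n})) / real n
      \<le> real (card (A \<inter> {0..<n})) / real n + real (card (B \<inter> {0..<n})) / real n" for n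
  proof -
    have "card ((A \<union> B) \<inter> {0..<n}) \<le> card (A \<inter> {0..<n}) + card (B \<inter> {0..<n})"
      by (metis Int_Un_distrib2 card_Un_le)
    then have "real (card ((A \<union> B) \<inter> {0..<n})) \<le> real (card (A \<inter> {0..<n}) + card (B \<inter> {0..<n}))"
      by (rule of_nat_mono)
    then show ?thesis
      by (simp add: divide_right_mono flip: add_divide_distrib)
  qed
  then show ?thesis
    unfolding has_density_iff_tendsto
    by (intro tendsto_sandwich[where f = "\<lambda>_. 0", OF _ _ tendsto_const lim]) auto
qed

text \<open>Each tolerance in statistical convergence will involve only finitely many shifts of
  \<open>A\<close>, so finite unions suffice.\<close>

lemma has_density_0_UN_atMost:
  assumes "\<And>i. has_density (A i) 0"
  shows "has_density (\<Union>i\<le>m::nat. A i) 0"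
proof (induction m)
  case (Suc m)
  then show ?case
    using has_density_0_Un[OF assms[of "Suc m"]] by (simp add: atMost_Suc)
qed (simp add: assms)

section \<open>Points of the circle with digits on a prescribed support\<close>

text \<open>Halving the ratio keeps the quotient of digit by ratio well away from the integers. For
  an arithmetic sequence \<open>ratio a 0 = 1\<close>, so the term at index 0 vanishes even if
  \<open>0 \<in> S\<close>.\<close>

definition digit_term :: "(nat \<Rightarrow> nat) \<Rightarrow> nat set \<Rightarrow> nat \<Rightarrow> real" where
  "digit_term a S j = (if j \<in> S then real (ratio a j div 2) / real (a j) else 0)"

definition support_point :: "(nat \<Rightarrow> nat) \<Rightarrow> nat set \<Rightarrow> real" where
  "support_point a S = (\<Sum>j. digit_term a S j)"

lemma infdist_Ints_ge_quarter:
  fixes x :: real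
  assumes "1 / 4 \<le> x" "x \<le> 3 / 4"
  shows "1 / 4 \<le> infdist x \<int>"
proof -
  have "1 / 4 \<le> \<bar>x - of_int z\<bar>" for z :: int
  proof (cases "z \<le> 0")
    case True
    then have "real_of_int z \<le> 0" by simp
    then show ?thesis using assms by linarith
  next
    case False
    then have "real_of_int z \<ge> 1" by simp
    then show ?thesis using assms by linarith
  qed
  then show ?thesis by (simp add: infdist_Ints_eq_round)
qed

locale arithmetic_sequence =
  fixes a :: "nat \<Rightarrow> nat"
  assumes arithmetic: "arithmetic_seq a"
begin

section \<open>Growth and divisibility of \<open>a\<close>\<close>

lemma strict_mono_a: "strict_mono a"
  using arithmetic by (simp add: arithmetic_seq_def)

lemma a_0: "a 0 = 1"
  using arithmetic by (simp add: arithmetic_seq_def)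

lemma a_pos: "0 < a n"
  using strict_mono_less_eq[OF strict_mono_a, of 0 n] a_0 by simp

lemma a_Suc: "a (Suc n) = ratio a (Suc n) * a n"
  using arithmetic by (simp add: arithmetic_seq_def ratio_def)

lemma ratio_ge_2: "2 \<le> ratio a (Suc n)"
proof -
  have "1 * a n < ratio a (Suc n) * a n"
    using strict_monoD[OF strict_mono_a, of n "Suc n"] a_Suc[of n] by simp
  then show ?thesis by (metis Suc_1 Suc_leI mult_less_cancel2)
qed

lemma a_dvd: "m \<le> n \<Longrightarrow> a m dvd a n"
  by (induction n rule: dec_induct) (simp_all add: a_Suc)

lemma a_mult_power_le: "a n * 2 ^ m \<le> a (n + m)"
proof (induction m)
  case (Suc m)
  then have "2 * (a n * 2 ^ m) \<le> ratio a (Suc (n + m)) * a (n + m)"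
    using ratio_ge_2 by (intro mult_le_mono) auto
  then show ?case by (simp add: a_Suc)
qed simp

lemma a_divide_le: "real (a n) / real (a (n + m)) \<le> 1 / 2 ^ m"
proof -
  have "real (a n) * 2 ^ m \<le> real (a (n + m))"
    using of_nat_mono[OF a_mult_power_le, where 'a = real] by simp
  then show ?thesis using a_pos[of "n + m"] by (simp add: divide_le_eq pos_le_divide_eq)
qed

lemma inverse_a_tendsto_0: "(\<lambda>n. 1 / real (a n)) \<longlonglongrightarrow> 0"
  using LIMSEQ_subseq_LIMSEQ[OF lim_1_over_n[where 'a = real] strict_mono_a] by (simp add: o_def)

section \<open>Convergence and tails of the digit series\<close>

lemma digit_term_nonneg: "0 \<le> digit_term a S j"
  by (simp add: digit_term_def)

text \<open>A digit is at most the ratio minus one, and that maximal digit over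
  \<open>a (Suc j)\<close> is exactly the difference on the right. The telescoping majorant yields
  both summability and the tail bound \<open>1 / a p\<close>.\<close>

lemma digit_term_Suc_le: "digit_term a S (Suc j) \<le> 1 / real (a j) - 1 / real (a (Suc j))"
proof -
  have "ratio a (Suc j) div 2 + 1 \<le> ratio a (Suc j)"
    using ratio_ge_2[of j] by simp
  then have *: "real (ratio a (Suc j) div 2) + 1 \<le> real (ratio a (Suc j))"
    by (metis of_nat_1 of_nat_add of_nat_le_iff)
  have "1 / real (a j) - 1 / real (a (Suc j)) = (real (ratio a (Suc j)) - 1) / real (a (Suc j))"
    using a_pos[of j] ratio_ge_2[of j] by (simp add: a_Suc field_simps)
  moreover have "\<dots> \<ge> real (ratio a (Suc j) div 2) / real (a (Suc j))"
    using * by (intro divide_right_mono) auto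
  moreover have "0 \<le> (real (ratio a (Suc j)) - 1) / real (a (Suc j))"
    using ratio_ge_2[of j] by simp
  ultimately show ?thesis
    by (simp add: digit_term_def)
qed

lemma telescope_sums_inverse_a:
  "(\<lambda>n. 1 / real (a (n + p)) - 1 / real (a (Suc (n + p)))) sums (1 / real (a p))"
  using telescope_sums'[OF LIMSEQ_ignore_initial_segment[OF inverse_a_tendsto_0, of p]] by simp

lemma summable_digit_term: "summable (digit_term a S)"
proof -
  have "summable (\<lambda>n. digit_term a S (Suc n))"
  proof (rule summable_comparison_test'[of _ 0])
    show "summable (\<lambda>n. 1 / real (a n) - 1 / real (a (Suc n)))"
      using sums_summable[OF telescope_sums_inverse_a[of 0]] by simp
  qed (use digit_term_nonneg digit_term_Suc_le in auto)
  then show ?thesis by (simp add: summable_Suc_iff)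
qed

lemma digit_tail_bounds:
  shows "0 \<le> (\<Sum>n. digit_term a S (n + Suc p))"
    and "(\<Sum>n. digit_term a S (n + Suc p)) \<le> 1 / real (a p)"
proof -
  have s: "summable (\<lambda>n. digit_term a S (n + Suc p))"
    using summable_digit_term by (rule summable_ignore_initial_segment)
  show "0 \<le> (\<Sum>n. digit_term a S (n + Suc p))"
    by (intro suminf_nonneg s digit_term_nonneg)
  show "(\<Sum>n. digit_term a S (n + Suc p)) \<le> 1 / real (a p)"
    using suminf_le[OF _ s sums_summable[OF telescope_sums_inverse_a[of p]]]
      digit_term_Suc_le[of S] sums_unique[OF telescope_sums_inverse_a[of p]] by simp
qed

section \<open>Distance of multiples of a support point from the integers\<close>

lemma digit_term_mult_Ints:
  assumes "j \<le> q"
  shows "real (a q) * digit_term a S j \<in> \<int>"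
proof -
  obtain c where "a q = a j * c" using a_dvd[OF assms] by blast
  then show ?thesis using a_pos[of j] by (simp add: digit_term_def)
qed

text \<open>Multiplication by \<open>a k\<close> makes the terms up to \<open>k\<close> integral,
  and the terms in \<open>{k<..p}\<close> vanish by hypothesis. Modulo the integers only the tail
  \<open>R\<close> beyond \<open>p\<close> survives.\<close>

lemma support_point_split:
  assumes "S \<inter> {k<..p} = {}" "k \<le> p"
  obtains R where "real (a k) * support_point a S - real (a k) * R \<in> \<int>"
    and "0 \<le> R" "R \<le> 1 / real (a p)"
proof -
  define R where "R = (\<Sum>n. digit_term a S (n + Suc p))"
  have "support_point a S = R + (\<Sum>j<Suc p. digit_term a S j)"
    unfolding support_point_def R_def
    by (rule suminf_split_initial_segment[OF summable_digit_term])
  moreover have "(\<Sum>j<Suc p. digit_term a S j) = (\<Sum>j\<le>k. digit_term a S j)"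
    using assms by (intro sum.mono_neutral_right) (auto simp: digit_term_def)
  ultimately have "real (a k) * support_point a S - real (a k) * R
      = (\<Sum>j\<le>k. real (a k) * digit_term a S j)"
    by (simp add: algebra_simps sum_distrib_left)
  also have "\<dots> \<in> \<int>"
    by (intro Ints_sum digit_term_mult_Ints) simp
  finally show ?thesis
    using that[of R] digit_tail_bounds[of S p] unfolding R_def by blast
qed

text \<open>The factor \<open>r\<close> is there because the members of \<open>e\<close> have the
  form \<open>r * a k\<close>; integrality of the split survives multiplication by
  \<open>r\<close>.\<close>

lemma infdist_mult_support_point_le:
  assumes "S \<inter> {k<..p} = {}" "k \<le> p"
  shows "infdist (real (r * a k) * support_point a S) \<int> \<le> real (r * a k) / real (a p)"
proof -
  obtain R where R: "real (a k) * support_point a S - real (a k) * R \<in> \<int>"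
    "0 \<le> R" "R \<le> 1 / real (a p)"
    using support_point_split[OF assms] .
  have "real r * (real (a k) * support_point a S - real (a k) * R) \<in> \<int>"
    using R(1) by (intro Ints_mult) auto
  then have "infdist (real (r * a k) * support_point a S) \<int> = infdist (real (r * a k) * R) \<int>"
    by (intro infdist_Ints_cong) (simp add: algebra_simps)
  also have "\<dots> \<le> real (r * a k) * R"
    using infdist_Ints_le[of "real (r * a k) * R" 0] R(2) by simp
  also have "\<dots> \<le> real (r * a k) * (1 / real (a p))"
    using R(3) by (intro mult_left_mono) auto
  finally show ?thesis by simp
qed

text \<open>Three empty positions after \<open>k\<close> give the factor \<open>1 / 2 ^ 3\<close>.
  The distance to the bound \<open>1 / 4\<close> of the next lemma is what later allows
  \<open>S\<close> to be decoded.\<close>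

lemma infdist_support_point_le_eighth:
  assumes "S \<inter> {k<..k + 3} = {}"
  shows "infdist (real (a k) * support_point a S) \<int> \<le> 1 / 8"
proof -
  have "infdist (real (a k) * support_point a S) \<int> \<le> real (a k) / real (a (k + 3))"
    using infdist_mult_support_point_le[of S k "k + 3" 1] assms by simp
  also have "\<dots> \<le> 1 / 8" using a_divide_le[of k 3] by simp
  finally show ?thesis .
qed

text \<open>The digit at \<open>Suc k\<close> contributes between \<open>1 / 3\<close> and
  \<open>1 / 2\<close>, the later ones at most \<open>1 / 8\<close>. Modulo the integers the value
  therefore lies in \<open>[1 / 4, 3 / 4]\<close>.\<close>

lemma infdist_support_point_ge_quarter:
  assumes "Suc k \<in> S" "S \<inter> {Suc k<..Suc k + 2} = {}"
  shows "1 / 4 \<le> infdist (real (a k) * support_point a S) \<int>"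
proof -
  define b where "b = ratio a (Suc k)"
  have b2: "2 \<le> b" unfolding b_def by (rule ratio_ge_2)
  \<comment> \<open>Without \<open>Suc k\<close> the support misses all of
    \<open>{k<..k + 3}\<close>, so the splitting lemma applies to \<open>T\<close> and the digit at
    \<open>Suc k\<close> is added separately.\<close>
  define T where "T = S - {Suc k}"
  have "T \<inter> {k<..k + 3} = {}" using assms(2) unfolding T_def by force
  then obtain R where R: "real (a k) * support_point a T - real (a k) * R \<in> \<int>"
    "0 \<le> R" "R \<le> 1 / real (a (k + 3))"
    using support_point_split[of T k "k + 3"] by auto
  have split: "(\<lambda>j. (if j = Suc k then digit_term a S (Suc k) else 0) + digit_term a T j) = digit_term a S"
    by (auto simp: digit_term_def T_def)
  have "(\<lambda>j. (if j = Suc k then digit_term a S (Suc k) else 0) + digit_term a T j) sums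
      (digit_term a S (Suc k) + support_point a T)"
    unfolding support_point_def
    by (intro sums_add sums_single[of _ "\<lambda>_. digit_term a S (Suc k)"]
        summable_sums[OF summable_digit_term])
  then have "digit_term a S sums (digit_term a S (Suc k) + support_point a T)"
    by (simp only: split)
  then have "support_point a S = digit_term a S (Suc k) + support_point a T"
    unfolding support_point_def[of a S] by (rule sums_unique[symmetric])
  moreover have "real (a k) * digit_term a S (Suc k) = real (b div 2) / real b"
    using assms(1) a_pos[of k] b2 by (simp add: digit_term_def a_Suc b_def)
  ultimately have eq: "infdist (real (a k) * support_point a S) \<int>
      = infdist (real (b div 2) / real b + real (a k) * R) \<int>"
    using R(1) by (intro infdist_Ints_cong) (simp add: algebra_simps)
  \<comment> \<open>The extreme case is \<open>b = 3\<close>.\<close>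
  have "1 / 3 \<le> real (b div 2) / real b"
  proof -
    have "b \<le> 3 * (b div 2)"
      using b2 mult_div_mod_eq[of 2 b] mod_less_divisor[of 2 b] by linarith
    then have "real b \<le> 3 * real (b div 2)" by (metis of_nat_le_iff of_nat_mult of_nat_numeral)
    then show ?thesis using b2 by (simp add: field_simps)
  qed
  moreover have "real (b div 2) / real b \<le> 1 / 2"
  proof -
    have "2 * (b div 2) \<le> b" by simp
    then have "2 * real (b div 2) \<le> real b" by (metis of_nat_le_iff of_nat_mult of_nat_numeral)
    then show ?thesis using b2 by (simp add: field_simps)
  qed
  moreover have "real (a k) * R \<le> 1 / 8"
  proof -
    have "real (a k) * R \<le> real (a k) / real (a (k + 3))"
      using mult_left_mono[OF R(3), of "real (a k)"] by simp
    also have "\<dots> \<le> 1 / 8" using a_divide_le[of k 3] by simp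
    finally show ?thesis .
  qed
  moreover have "0 \<le> real (a k) * R" using R(2) by simp
  ultimately show ?thesis
    unfolding eq by (intro infdist_Ints_ge_quarter) linarith+
qed

section \<open>Elements of an arithmetic-type sequence\<close>

lemma infinite_d_set: "infinite (d_set a)"
proof -
  have "a k \<in> d_set a" for k
    unfolding d_set_def using ratio_ge_2[of k] by (intro CollectI exI[of _ 1] exI[of _ k]) simp
  then have "range a \<subseteq> d_set a" by blast
  moreover have "infinite (range a)"
    using strict_mono_imp_inj_on[OF strict_mono_a] by (rule range_inj_infinite)
  ultimately show ?thesis using infinite_super by blast
qed

text \<open>An element \<open>r * a j\<close> with an admissible \<open>r\<close> lies in
  \<open>[a j, a (Suc j))\<close>; these intervals are disjoint, which forces
  \<open>j = k\<close>.\<close>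

lemma d_set_block:
  assumes "x \<in> d_set a" "a k \<le> x" "x < a (Suc k)"
  obtains r where "x = r * a k"
proof -
  obtain r j where x: "x = r * a j" and r: "1 \<le> r" "r < ratio a (Suc j)"
    using assms(1) by (auto simp: d_set_def)
  have "a j \<le> x" using r(1) x by simp
  then have "a j < a (Suc k)" using assms(3) by simp
  then have "j \<le> k" using strict_mono_less[OF strict_mono_a] by simp
  have "x < a (Suc j)" using r(2) x a_pos[of j] by (simp add: a_Suc)
  then have "a k < a (Suc j)" using assms(2) by simp
  then have "k \<le> j" using strict_mono_less[OF strict_mono_a] by simp
  with \<open>j \<le> k\<close> x that show ?thesis by auto
qed

end

locale arithmetic_type_sequence = arithmetic_sequence +
  fixes e :: "nat \<Rightarrow> nat"
  assumes arithmetic_type: "arithmetic_type_seq a e"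
begin

section \<open>Blocks of indices cut out by \<open>a_index\<close>\<close>

lemma strict_mono_on_e: "strict_mono_on {1..} e"
  using arithmetic_type by (simp add: arithmetic_type_seq_def)

lemma e_less_iff: "1 \<le> m \<Longrightarrow> 1 \<le> n \<Longrightarrow> e m < e n \<longleftrightarrow> m < n"
  using strict_mono_on_less[OF strict_mono_on_e] by simp

lemma e_in_d_set: "1 \<le> n \<Longrightarrow> e n \<in> d_set a"
  using arithmetic_type enumerate_in_set[OF infinite_d_set]
  unfolding arithmetic_type_seq_def d_seq_def by metis

lemma a_index_ge_1: "1 \<le> a_index a e k" and e_a_index: "e (a_index a e k) = a k"
proof -
  have "\<exists>!n. 1 \<le> n \<and> e n = a k"
  proof (rule ex_ex1I)
    show "\<exists>n. 1 \<le> n \<and> e n = a k"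
      using arithmetic_type by (metis arithmetic_type_seq_def)
    show "m = n" if "1 \<le> m \<and> e m = a k" "1 \<le> n \<and> e n = a k" for m n
      using that e_less_iff by (metis less_irrefl nat_neq_iff)
  qed
  from theI'[OF this] show "1 \<le> a_index a e k" "e (a_index a e k) = a k"
    by (auto simp: a_index_def)
qed

lemma strict_mono_a_index: "strict_mono (a_index a e)"
proof (rule strict_monoI)
  fix i j :: nat assume "i < j"
  then show "a_index a e i < a_index a e j"
    using strict_monoD[OF strict_mono_a] e_less_iff[OF a_index_ge_1 a_index_ge_1] by (simp add: e_a_index)
qed

text \<open>All values of \<open>e\<close> on \<open>{1..}\<close> are positive, so none precedes
  \<open>a 0 = 1\<close>. Hence the blocks start at 1 and cover every index.\<close>

lemma a_index_0: "a_index a e 0 = 1"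
proof -
  have "0 < e 1"
    using e_in_d_set[of 1] a_pos by (auto simp: d_set_def)
  then have "\<not> e 1 < e (a_index a e 0)"
    by (simp add: e_a_index a_0)
  then show ?thesis
    using a_index_ge_1[of 0] e_less_iff[of 1 "a_index a e 0"] by simp
qed

lemma index_in_block:
  assumes "1 \<le> n"
  obtains k r where "a_index a e k \<le> n" "n < a_index a e (Suc k)"
    and "e n = r * a k" "e n < a (Suc k)"
proof -
  define k where "k = (GREATEST k. a_index a e k \<le> n)"
  \<comment> \<open>Strict monotonicity gives \<open>j \<le> a_index a e j\<close>, so the maximum
    defining \<open>k\<close> exists.\<close>
  have bound: "j \<le> n" if "a_index a e j \<le> n" for j
    using that strict_mono_imp_increasing[OF strict_mono_a_index, of j] by simp
  have k: "a_index a e k \<le> n"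
    unfolding k_def
  proof (rule GreatestI_nat[where k = 0 and b = n])
    show "a_index a e 0 \<le> n" using assms a_index_0 by simp
  qed (rule bound)
  have k': "n < a_index a e (Suc k)"
  proof (rule ccontr)
    assume "\<not> n < a_index a e (Suc k)"
    then have "a_index a e (Suc k) \<le> n" by simp
    then have "Suc k \<le> k"
      unfolding k_def using bound by (rule Greatest_le_nat)
    then show False by simp
  qed
  have "\<not> e n < e (a_index a e k)" "e n < e (a_index a e (Suc k))"
    using k k' assms a_index_ge_1 by (auto simp: e_less_iff)
  then have "a k \<le> e n" "e n < a (Suc k)" by (simp_all add: e_a_index)
  with that k k' d_set_block[OF e_in_d_set[OF assms]] show ?thesis by metis
qed

text \<open>If \<open>S\<close> had no element in the \<open>m + 1\<close> positions after
  \<open>k\<close>, the norm would be at most \<open>1 / 2 ^ m\<close>. An element \<open>j\<close>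
  found there puts \<open>Suc k\<close> into the shift of \<open>A\<close> by
  \<open>j - Suc k \<le> m\<close>.\<close>

lemma norm_ge_imp_in_lifting:
  assumes "S \<subseteq> A" and "1 \<le> n"
    and "1 / 2 ^ m < infdist (real (e n) * support_point a S) \<int>"
  shows "n \<in> (\<Union>i\<le>m. lifting a e (shift_down A i))"
proof -
  obtain k r where k: "a_index a e k \<le> n" "n < a_index a e (Suc k)"
    "e n = r * a k" "e n < a (Suc k)"
    using index_in_block[OF assms(2)] .
  have "S \<inter> {k<..Suc k + m} \<noteq> {}"
  proof
    assume "S \<inter> {k<..Suc k + m} = {}"
    then have "infdist (real (e n) * support_point a S) \<int> \<le> real (e n) / real (a (Suc k + m))"
      using infdist_mult_support_point_le[of S k "Suc k + m" r] k(3) by simp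
    also have "\<dots> \<le> real (a (Suc k)) / real (a (Suc k + m))"
      using k(4) by (intro divide_right_mono) auto
    also have "\<dots> \<le> 1 / 2 ^ m" by (rule a_divide_le)
    finally show False using assms(3) by simp
  qed
  then obtain j where j: "j \<in> S" "k < j" "j \<le> Suc k + m" by auto
  then have "Suc k \<in> shift_down A (j - Suc k)"
    using assms(1) by (auto simp: shift_down_def intro!: bexI[of _ j])
  then have "n \<in> lifting a e (shift_down A (j - Suc k))"
    \<comment> \<open>\<open>lifting\<close> attaches the block from \<open>a_index a e k\<close> to
      the index \<open>Suc k\<close>, not to \<open>k\<close>.\<close>
    using k(1,2) unfolding lifting_def by (intro UN_I[of "Suc k"]) auto
  then show ?thesis using j(3) by (intro UN_I[of "j - Suc k"]) auto
qed

lemma support_point_in_stat_char_subgroup: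
  assumes "S \<subseteq> A" and "\<And>m. has_density (lifting a e (shift_down A m)) 0"
  shows "abs_circle (support_point a S) \<in> stat_char_subgroup e"
  unfolding stat_char_subgroup_def
proof (intro CollectI allI impI)
  fix \<epsilon> :: real assume "\<epsilon> > 0"
  then obtain m where m: "1 / 2 ^ m < \<epsilon>"
    using real_arch_pow_inv[of \<epsilon> "1 / 2"] by (auto simp: power_one_over)
  have "{n. 1 \<le> n \<and> \<epsilon> \<le> circle_norm (circle_mult (e n) (abs_circle (support_point a S)))}
      \<subseteq> (\<Union>i\<le>m. lifting a e (shift_down A i))"
    using norm_ge_imp_in_lifting[OF assms(1)] m
    by (auto simp: circle_mult.abs_eq circle_norm.abs_eq simp del: UN_iff)
  from has_density_0_subset[OF has_density_0_UN_atMost[OF assms(2)] this]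
  show "has_density
      {n. 1 \<le> n \<and> \<epsilon> \<le> circle_norm (circle_mult (e n) (abs_circle (support_point a S)))} 0" .
qed

text \<open>Along the subsequence \<open>a k\<close> with \<open>Suc k \<in> S\<close> the norm
  stays at least \<open>1 / 4\<close>.\<close>

lemma support_point_notin_char_subgroup:
  assumes "infinite S" and "\<And>k. k \<in> S \<Longrightarrow> S \<inter> {k<..k + 2} = {}"
  shows "abs_circle (support_point a S) \<notin> char_subgroup e"
proof
  assume "abs_circle (support_point a S) \<in> char_subgroup e"
  then have "(\<lambda>n. circle_mult (e n) (abs_circle (support_point a S))) \<longlonglongrightarrow> 0"
    by (simp add: char_subgroup_def)
  then have "\<forall>\<^sub>F n in sequentially. dist (circle_mult (e n) (abs_circle (support_point a S))) 0 < 1 / 4"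
    by (rule tendstoD) simp
  then obtain N where N: "\<And>n. N \<le> n \<Longrightarrow> infdist (real (e n) * support_point a S) \<int> < 1 / 4"
    by (auto simp: eventually_sequentially dist_circle_def circle_mult.abs_eq circle_norm.abs_eq)
  obtain j where j: "j \<in> S" "N < j"
    using assms(1) by (auto simp: infinite_nat_iff_unbounded)
  then obtain k where k: "j = Suc k" by (cases j) auto
  have "N \<le> a_index a e k"
    using j(2) k strict_mono_imp_increasing[OF strict_mono_a_index, of k] by simp
  from N[OF this] infdist_support_point_ge_quarter[of k S] j(1) k assms(2)[of j]
  show False by (simp add: e_a_index)
qed

end

section \<open>Continuum many points\<close>

lemma infinite_residue_class:
  fixes A :: "nat set"
  assumes "infinite A" "0 < q"
  obtains c where "infinite {n \<in> A. n mod q = c}"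
proof -
  have "finite ((\<lambda>n. n mod q) ` A)"
    by (rule finite_subset[of _ "{..<q}"]) (use assms(2) in auto)
  then show ?thesis
    using pigeonhole_infinite[OF assms(1)] that by blast
qed

lemma circle_lepoll_real: "(UNIV :: circle set) \<lesssim> (UNIV :: real set)"
proof -
  have "inj rep_circle"
    by (metis Quotient3_abs_rep Quotient3_circle injI)
  then show ?thesis unfolding lepoll_def by blast
qed

text \<open>Membership of \<open>Suc k\<close> is read off from multiplication by
  \<open>a k\<close>: the norm is at least \<open>1 / 4\<close> if it belongs to the support and at
  most \<open>1 / 8\<close> if not.\<close>

lemma inj_on_support_point:
  assumes "arithmetic_seq a" and "B \<subseteq> {1..}"
    and gap: "\<And>k. k \<in> B \<Longrightarrow> B \<inter> {k<..k + 2} = {}"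
  shows "inj_on (\<lambda>S. abs_circle (support_point a S)) (Pow B)"
proof (rule inj_onI)
  interpret arithmetic_sequence a by unfold_locales fact
  have sub: "S \<subseteq> T"
    if ST: "S \<subseteq> B" "T \<subseteq> B" and eq: "abs_circle (support_point a S) = abs_circle (support_point a T)"
    for S T
  proof (rule subsetI, rule ccontr)
    fix j assume j: "j \<in> S" "j \<notin> T"
    then obtain k where k: "j = Suc k" using ST(1) assms(2) by (cases j) auto
    have gap_j: "B \<inter> {Suc k<..Suc k + 2} = {}" using gap[of j] j ST(1) k by auto
    have "support_point a S - support_point a T \<in> \<int>"
      using eq by (simp add: circle.abs_eq_iff)
    then have "real (a k) * (support_point a S - support_point a T) \<in> \<int>"
      by (intro Ints_mult) auto
    then have "infdist (real (a k) * support_point a S) \<int> = infdist (real (a k) * support_point a T) \<int>"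
      by (intro infdist_Ints_cong) (simp add: algebra_simps)
    moreover have "1 / 4 \<le> infdist (real (a k) * support_point a S) \<int>"
      using j(1) k gap_j ST(1) by (intro infdist_support_point_ge_quarter) auto
    moreover have "infdist (real (a k) * support_point a T) \<int> \<le> 1 / 8"
    proof (rule infdist_support_point_le_eighth)
      \<comment> \<open>\<open>T\<close> omits \<open>Suc k\<close> by choice of \<open>j\<close>;
        it omits the next two positions because \<open>j\<close> lies in \<open>B\<close> and
        \<open>B\<close> has gaps there.\<close>
      have "{k<..k + 3} = insert (Suc k) {Suc k<..Suc k + 2}" by auto
      then show "T \<inter> {k<..k + 3} = {}" using j(2) k gap_j ST(2) by auto
    qed
    ultimately show False by simp
  qed
  fix S T assume "S \<in> Pow B" "T \<in> Pow B"
    "abs_circle (support_point a S) = abs_circle (support_point a T)"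
  then show "S = T" using sub[of S T] sub[of T S] by auto
qed

lemma nat_sets_lepoll_infinite_subsets:
  fixes B :: "nat set"
  assumes "infinite B"
  shows "(UNIV :: nat set set) \<lesssim> {S. S \<subseteq> B \<and> infinite S}"
proof -
  \<comment> \<open>The odd numbers encode \<open>X\<close>; all even numbers are adjoined to make
    the set infinite.\<close>
  define E :: "nat set \<Rightarrow> nat set" where "E X = {n. even n \<or> n div 2 \<in> X}" for X
  have inj: "inj (enumerate B)"
    using strict_mono_enumerate[OF assms] by (rule strict_mono_imp_inj_on)
  have "X = {i. 2 * i + 1 \<in> E X}" for X by (auto simp: E_def)
  then have "inj E" by (metis injI)
  then have "inj (\<lambda>X. enumerate B ` E X)"
    by (simp add: inj_def inj_image_eq_iff[OF inj])
  moreover have "infinite (enumerate B ` E X)" for X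
  proof -
    have "range (\<lambda>i. 2 * i) \<subseteq> E X" by (auto simp: E_def)
    moreover have "infinite (range (\<lambda>i::nat. 2 * i))"
      by (intro range_inj_infinite injI) simp
    ultimately have "infinite (E X)" using infinite_super by blast
    then show ?thesis using inj by (simp add: finite_image_iff inj_on_subset)
  qed
  ultimately show ?thesis
    unfolding lepoll_def using enumerate_in_set[OF assms] by blast
qed

theorem theorem3p6:
  fixes a e :: "nat \<Rightarrow> nat"
  assumes "arithmetic_seq a"
    and "arithmetic_type_seq a e"
    and "weakly_L_invariant a e"
  shows "stat_char_subgroup e - char_subgroup e \<approx> (UNIV :: real set)"
proof (rule lepoll_antisym)
  interpret arithmetic_type_sequence a e
    using assms by unfold_locales
  show "stat_char_subgroup e - char_subgroup e \<lesssim> (UNIV :: real set)"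
    using subset_imp_lepoll[OF subset_UNIV] circle_lepoll_real by (rule lepoll_trans)
  obtain A where A: "A \<subseteq> {1..}" "infinite A"
    and null: "\<And>m. has_density (lifting a e (shift_down A m)) 0"
    using assms(3) by (auto simp: weakly_L_invariant_def)
  obtain c where c: "infinite {n \<in> A. n mod 3 = c}"
    using infinite_residue_class[OF A(2), of 3] by auto
  \<comment> \<open>Distinct elements of one residue class modulo 3 differ by at least 3, which
    supplies the gaps; \<open>B \<subseteq> A\<close> preserves the density hypothesis.\<close>
  define B where "B = {n \<in> A. n mod 3 = c}"
  have gap: "B \<inter> {k<..k + 2} = {}" if "k \<in> B" for k
  proof -
    have "l mod 3 \<noteq> k mod 3" if "k < l" "l \<le> k + 2" for l
      using that by presburger
    with \<open>k \<in> B\<close> show ?thesis by (fastforce simp: B_def)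
  qed
  \<comment> \<open>Infinite supports are required to leave \<open>char_subgroup e\<close>, and
    there are still continuum many of them.\<close>
  let ?F = "{S. S \<subseteq> B \<and> infinite S}"
  have "inj_on (\<lambda>S. abs_circle (support_point a S)) ?F"
  proof (rule inj_on_subset)
    show "inj_on (\<lambda>S. abs_circle (support_point a S)) (Pow B)"
      using A(1) gap by (intro inj_on_support_point assms(1)) (auto simp: B_def)
  qed auto
  moreover have "(\<lambda>S. abs_circle (support_point a S)) ` ?F \<subseteq> stat_char_subgroup e - char_subgroup e"
  proof (intro image_subsetI DiffI)
    fix S assume "S \<in> ?F"
    then have S: "S \<subseteq> B" "infinite S" by auto
    show "abs_circle (support_point a S) \<in> stat_char_subgroup e"
      using S(1) null by (intro support_point_in_stat_char_subgroup[of _ A]) (auto simp: B_def)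
    show "abs_circle (support_point a S) \<notin> char_subgroup e"
      using S gap by (intro support_point_notin_char_subgroup) blast+
  qed
  ultimately have "?F \<lesssim> stat_char_subgroup e - char_subgroup e"
    unfolding lepoll_def by blast
  moreover have "(UNIV :: real set) \<lesssim> (UNIV :: nat set set)"
    using nat_sets_eqpoll_reals by (meson eqpoll_imp_lepoll eqpoll_sym)
  ultimately show "(UNIV :: real set) \<lesssim> stat_char_subgroup e - char_subgroup e"
    using nat_sets_lepoll_infinite_subsets[of B] c
    by (auto simp: B_def intro: lepoll_trans)
qed

end
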